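(* Let $\Phi:\mathbb{R}\to\mathbb{R}$ be a convex and nondecreasing function. Then for $f\in\mathcal{U}(\lambda)$ with $0<\lambda\le1$ and for $0<r<1$, $$\int_{-\pi}^{\pi}\Phi\left(\pm\log|f(re^{i\theta})|\right)d\theta\le\int_{-\pi}^{\pi}\Phi\left(\pm\log|k_\lambda(re^{i\theta})|\right)d\theta,$$ where $k_\lambda(z)=\dfrac{z}{(1-z)(1-\lambda z)}$; that is, the inequality holds with the sign $+$ on both sides and also with the sign $-$ on both sides.
   Context: $\mathbb{D}=\{z\in\mathbb{C}:|z|<1\}$. $\mathcal{A}$ is the set of analytic functions on $\mathbb{D}$ of the form $f(z)=z+\sum_{n=2}^\infty a_nz^n$. For $0<\lambda\le1$, $\mathcal{U}(\lambda)$ is the class of $f\in\mathcal{A}$ satisfying $\left|f'(z)\left(\frac{z}{f(z)}\right)^2-1\right|<\lambda$ for all $z\in\mathbb{D}$ (where $z/f(z)$ has the value $1$ at $z=0$; such $f$ is nonvanishing in $\mathbb{D}\setminus\{0\}$). *)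

theory Defs
  imports "HOL-Complex_Analysis.Complex_Analysis"
begin

abbreviation unit_disc :: "complex set" where
  "unit_disc \<equiv> ball 0 1"

definition class_A :: "(complex \<Rightarrow> complex) set" where
  "class_A = {f. f analytic_on unit_disc \<and>
     (\<exists>a :: nat \<Rightarrow> complex. \<forall>z\<in>unit_disc. (\<lambda>n. a (n + 2) * z ^ (n + 2)) sums (f z - z))}"

text \<open>The quotient \<open>z / f z\<close>, with its removable singularity at the origin filled in.\<close>

definition z_over :: "(complex \<Rightarrow> complex) \<Rightarrow> complex \<Rightarrow> complex" where
  "z_over f z = (if z = 0 then 1 else z / f z)"

text \<open>
  The nonvanishing clause makes the quotient meaningful without reference to the convention
  \<open>z / 0 = 0\<close>; for \<open>l \<le> 1\<close> it excludes nothing, since at a zero of \<open>f\<close> off the origin that convention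
  would turn the inequality into \<open>1 < l\<close>.
\<close>

definition class_U :: "real \<Rightarrow> (complex \<Rightarrow> complex) set" where
  "class_U l = {f \<in> class_A.
     (\<forall>z\<in>unit_disc - {0}. f z \<noteq> 0) \<and>
     (\<forall>z\<in>unit_disc. cmod (deriv f z * (z_over f z)\<^sup>2 - 1) < l)}"

definition k_fun :: "real \<Rightarrow> complex \<Rightarrow> complex" where
  "k_fun l z = z / ((1 - z) * (1 - complex_of_real l * z))"

end

theory Submission
  imports Defs
begin

text \<open>
  Write \<open>p = z / f\<close> and \<open>k\<close> for \<open>k_fun l\<close>. The defining inequality says \<open>|p - z p' - 1| < l\<close>, and
  writing \<open>p = 1 + z A\<close> turns \<open>p - z p' - 1\<close> into \<open>- z\<^sup>2 A'\<close>; by the maximum principle \<open>|A'| \<le> l\<close>, so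
  that \<open>A\<close> is \<open>l\<close>-Lipschitz (\<open>class_U_reciprocal\<close>).

  The key point is that \<open>p\<close> has no zero in the disc. After \<open>A\<close> is extended continuously to
  the closed disc, Brouwer's theorem applied to \<open>z \<mapsto> - cnj (A z)\<close>, cut off to the closed disc,
  gives a fixed point; if the cut-off were active there, the Lipschitz bound with \<open>l \<le> 1\<close> would
  force a zero of \<open>p\<close>. Hence \<open>A c = - cnj c\<close> for some \<open>c\<close> in the closed
  disc, and the Lipschitz bound around \<open>c\<close> yields
  \<open>p = (1 - cnj c z) (1 - l \<omega>)\<close> with \<open>\<omega>\<close> holomorphic and \<open>|\<omega> z| \<le> |z|\<close>
  (\<open>zero_free_lipschitz_factorization\<close>). For the extremal function \<open>z / k = (1 - z) (1 - l z)\<close>.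

  The two factors have to be compared separately: \<open>p\<close> itself need not be subordinate to
  \<open>(1 - z) (1 - l z)\<close>. For instance \<open>p = (1 - z) (1 - l \<mu> z)\<close> with \<open>|\<mu>| = 1\<close> comes from a member
  of the class, but for \<open>l = 1/10\<close> and \<open>\<mu> = exp (\<i> \<pi> / 4)\<close> it takes values outside the image of
  \<open>(1 - z) (1 - l z)\<close>.

  For one factor, Littlewood's subordination principle compares the means of
  \<open>max 0 (\<plusminus> ln |1 - s \<omega>| - k)\<close> with those of \<open>max 0 (\<plusminus> ln |1 - s z| - k)\<close> for every level \<open>k\<close>
  (\<open>Littlewood_hinge\<close>, via the Poisson formula). The comparison survives addition of the two
  factors because \<open>|1 - z|\<close> and \<open>|1 - l z|\<close> both increase with \<open>|\<theta>|\<close> on a circle: the hinge of a sum is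
  at most a sum of hinges at suitable levels, with equality for comonotone summands
  (\<open>integral_convex_mono_le_comonotone_sum\<close>). Finally, a convex nondecreasing \<open>\<Phi>\<close> is, up to a small
  error, a constant plus a nonnegative combination of hinges
  (\<open>integral_convex_mono_le_of_hinge\<close>). The term \<open>\<plusminus> ln r\<close> from \<open>|z| = r\<close> only translates \<open>\<Phi>\<close>.
\<close>

section \<open>Factorization of z / f for functions of the class\<close>

text \<open>
  On the circle of radius \<open>R\<close> the hypothesis bounds \<open>G\<close> by \<open>l / R\<^sup>2\<close>, the maximum principle carries
  this bound inside, and \<open>R\<close> may tend to \<open>1\<close>.
\<close>
lemma norm_le_of_norm_square_mult_le:
  assumes hol: "G holomorphic_on ball 0 1"
    and bound: "\<And>z. z \<in> ball 0 1 \<Longrightarrow> cmod (z\<^sup>2 * G z) \<le> l" and z: "z \<in> ball 0 1"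
  shows "cmod (G z) \<le> l"
proof -
  have l0: "0 \<le> l" using bound[of 0] by simp
  have *: "cmod (G z) * R\<^sup>2 \<le> l" if R: "cmod z < R" "R < 1" for R
  proof -
    have R0: "R > 0" using R norm_ge_zero[of z] by linarith
    have "cmod (G z) \<le> l / R\<^sup>2"
    proof (rule maximum_modulus_frontier[of G "ball 0 R"])
      show "G holomorphic_on interior (ball 0 R)"
        using hol R by (auto intro: holomorphic_on_subset)
      show "continuous_on (closure (ball 0 R)) G"
        using hol R R0 by (auto intro!: holomorphic_on_imp_continuous_on intro: holomorphic_on_subset)
      show "cmod (G w) \<le> l / R\<^sup>2" if "w \<in> frontier (ball 0 R)" for w
      proof -
        have w: "cmod w = R" using that R0 by (simp add: frontier_ball)
        then show ?thesis using bound[of w] R R0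
          by (simp add: norm_mult norm_power pos_le_divide_eq mult.commute)
      qed
    qed (use R in auto)
    then show ?thesis using R0 by (simp add: pos_le_divide_eq)
  qed
  have "continuous_on {cmod z..1} (\<lambda>R. cmod (G z) * R\<^sup>2)" by (intro continuous_intros)
  moreover have cl: "closure {cmod z<..<1} = {cmod z..1}"
    using z by (intro closure_greaterThanLessThan) simp
  ultimately have "continuous_on (closure {cmod z<..<1}) (\<lambda>R. cmod (G z) * R\<^sup>2)"
    by simp
  then have "cmod (G z) * 1\<^sup>2 \<le> l"
    by (rule continuous_le_on_closure) (use z * cl in auto)
  then show ?thesis by simp
qed

text \<open>
  Here \<open>f z = z (1 + z g z)\<close> and \<open>1 + z A z\<close> is the reciprocal of \<open>1 + z g z\<close>. The Lipschitz bound
  comes from \<open>deriv f z * (z_over f z)\<^sup>2 - 1 = - z\<^sup>2 * deriv A z\<close>.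
\<close>
lemma class_U_reciprocal:
  assumes f: "f \<in> class_U l" and l: "0 \<le> l"
  obtains A where "A holomorphic_on ball 0 1" "l-lipschitz_on (ball 0 1) A"
    "\<And>z. z \<in> ball 0 1 \<Longrightarrow> 1 + z * A z \<noteq> 0"
    "\<And>z. z \<in> ball 0 1 \<Longrightarrow> z = f z * (1 + z * A z)"
proof -
  from f have nz: "\<And>z. z \<in> ball 0 1 \<Longrightarrow> z \<noteq> 0 \<Longrightarrow> f z \<noteq> 0"
    and bound: "\<And>z. z \<in> ball 0 1 \<Longrightarrow> cmod (deriv f z * (z_over f z)\<^sup>2 - 1) < l"
    and "f \<in> class_A"
    by (auto simp: class_U_def)
  then obtain a :: "nat \<Rightarrow> complex"
    where a: "\<And>z. z \<in> ball 0 1 \<Longrightarrow> (\<lambda>n. a (n + 2) * z ^ (n + 2)) sums (f z - z)"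
    unfolding class_A_def by blast
  have f0: "f 0 = 0"
    using a[of 0] sums_unique2[OF _ sums_zero, of "f 0"] by simp
  define g where "g z = (if z = 0 then a 2 else (f z - z) / z\<^sup>2)" for z
  have "g holomorphic_on ball 0 1"
  proof (rule power_series_holomorphic)
    fix w :: complex assume w: "w \<in> ball 0 1"
    show "(\<lambda>n. a (n + 2) * (w - 0) ^ n) sums g w"
    proof (cases "w = 0")
      case True
      then show ?thesis using powser_sums_zero[of "\<lambda>n. a (n + 2)"] by (simp add: g_def numeral_2_eq_2)
    next
      case False
      then have "(\<lambda>n. a (n + 2) * w ^ (n + 2) / w\<^sup>2) = (\<lambda>n. a (n + 2) * (w - 0) ^ n)"
        by (intro ext) (simp add: power2_eq_square)
      with sums_divide[OF a[OF w], of "w\<^sup>2"] False show ?thesis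
        by (simp only: g_def if_False)
    qed
  qed
  note holg = this
  have fg: "f z = z * (1 + z * g z)" for z
    by (cases "z = 0") (simp_all add: g_def f0 power2_eq_square distrib_left)
  have hnz: "1 + z * g z \<noteq> 0" if "z \<in> ball 0 1" for z
    using nz[OF that] fg[of z] by (cases "z = 0") auto
  define A where "A z = - g z / (1 + z * g z)" for z
  have holA: "A holomorphic_on ball 0 1"
    unfolding A_def using hnz by (intro holomorphic_intros holg) auto
  have p: "1 + z * A z = 1 / (1 + z * g z)" if "z \<in> ball 0 1" for z
    using hnz[OF that] by (simp add: A_def field_simps)
  have pnz: "1 + z * A z \<noteq> 0" if "z \<in> ball 0 1" for z
    using p[OF that] hnz[OF that] by simp
  have zfp: "z = f z * (1 + z * A z)" if "z \<in> ball 0 1" for z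
    unfolding p[OF that] using fg[of z] hnz[OF that] by simp
  have dA: "(A has_field_derivative deriv A z) (at z)" if "z \<in> ball 0 1" for z
    using holomorphic_derivI[OF holA open_ball that] .
  have "cmod (z\<^sup>2 * deriv A z) \<le> l" if z: "z \<in> ball 0 1" for z
  proof -
    define P where "P = 1 + z * A z"
    have "((\<lambda>w. w / (1 + w * A w)) has_field_derivative (P - z * (A z + z * deriv A z)) / P\<^sup>2) (at z)"
      unfolding P_def using pnz[OF z]
      by (auto intro!: derivative_eq_intros dA[OF z] simp: power2_eq_square algebra_simps)
    then have "(f has_field_derivative (P - z * (A z + z * deriv A z)) / P\<^sup>2) (at z)"
    proof (rule has_field_derivative_transform_within_open[OF _ open_ball z])
      fix w :: complex assume w: "w \<in> ball 0 1"
      show "w / (1 + w * A w) = f w" using zfp[OF w] pnz[OF w] by (simp add: divide_eq_eq)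
    qed
    then have "deriv f z = (P - z * (A z + z * deriv A z)) / P\<^sup>2"
      by (rule DERIV_imp_deriv)
    moreover have "z_over f z = P"
      using zfp[OF z] nz[OF z] by (auto simp: z_over_def P_def divide_eq_eq mult.commute)
    ultimately have "deriv f z * (z_over f z)\<^sup>2 = P - z * (A z + z * deriv A z)"
      using pnz[OF z] by (simp add: P_def)
    then have "deriv f z * (z_over f z)\<^sup>2 - 1 = - (z\<^sup>2 * deriv A z)"
      by (simp add: P_def power2_eq_square algebra_simps)
    then show ?thesis using bound[OF z] by simp
  qed
  then have dA_le: "cmod (deriv A z) \<le> l" if "z \<in> ball 0 1" for z
    by (rule norm_le_of_norm_square_mult_le[OF holomorphic_deriv[OF holA open_ball] _ that])
  have "cmod (A x - A y) \<le> l * cmod (x - y)" if "x \<in> ball 0 1" "y \<in> ball 0 1" for x y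
    by (rule field_differentiable_bound[OF convex_ball has_field_derivative_at_within[OF dA] dA_le that])
  then have "l-lipschitz_on (ball 0 1) A"
    by (intro lipschitz_onI l) (auto simp: dist_norm)
  from that[OF holA this pnz zfp] show thesis .
qed

text \<open>
  The idea is that the zeros of \<open>1 + z A z\<close> are governed by the map \<open>z \<mapsto> cnj z + A z\<close>, which agrees with
  \<open>(1 + z A z) / z\<close> on the unit circle. For \<open>l < 1\<close> it is a perturbation of \<open>z \<mapsto> cnj z\<close> by a contraction,
  hence orientation reversing with exactly one zero \<open>c\<close> in the plane, once \<open>A\<close> is extended. If \<open>c\<close> lay outside the closed disc, the
  winding number of \<open>1 + z A z\<close> along the circle would be one and this function would have a zero
  in the disc. The proof makes this precise without degrees, and so that \<open>l = 1\<close> is included. The point \<open>c\<close> may lie on the unit circle, so the conclusion speaks of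
  \<open>cnj c + A z\<close> on the open disc instead of the value at \<open>c\<close>.
\<close>
lemma zero_free_lipschitz_reflected_fixed_point:
  fixes A :: "complex \<Rightarrow> complex"
  assumes hol: "A holomorphic_on ball 0 1" and lip: "l-lipschitz_on (ball 0 1) A" and l: "l \<le> 1"
    and nz: "\<And>z. z \<in> ball 0 1 \<Longrightarrow> 1 + z * A z \<noteq> 0"
  obtains c where "cmod c \<le> 1" "\<And>z. z \<in> ball 0 1 \<Longrightarrow> cmod (cnj c + A z) \<le> l * cmod (z - c)"
proof -
  obtain B where B: "l-lipschitz_on (closure (ball 0 1)) B" and BA: "\<And>z. z \<in> ball 0 1 \<Longrightarrow> B z = A z"
    using lipschitz_extend_closure[OF lip] by blast
  then have lipB: "l-lipschitz_on (cball 0 1) B" by simp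
  \<comment> \<open>\<open>T\<close> is the reflected map \<open>- cnj (B z)\<close> followed by the radial retraction onto the closed disc; \<open>t\<close> below
    is the factor by which the retraction shrinks at the fixed point.\<close>
  define T where "T z = - cnj (B z) / complex_of_real (max 1 (cmod (B z)))" for z
  have contB: "continuous_on (cball 0 1) B" using lipschitz_on_continuous_on[OF lipB] .
  obtain c where c: "c \<in> cball 0 1" "T c = c"
  proof (rule brouwer_ball[of 1 0 T])
    show "continuous_on (cball 0 1) T"
      unfolding T_def by (intro continuous_intros contB) (auto simp: max_def split: if_splits)
    show "T \<in> cball 0 1 \<rightarrow> cball 0 1"
      by (auto simp: T_def norm_divide divide_le_eq_1)
  qed auto
  define t where "t = max 1 (cmod (B c))"
  have t1: "t \<ge> 1" by (simp add: t_def)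
  have "T c * of_real t = - cnj (B c)"
    using t1 by (simp add: T_def t_def[symmetric])
  then have "- cnj (B c) = of_real t * c"
    using c(2) by (simp add: mult.commute)
  then have "cnj (- cnj (B c)) = cnj (of_real t * c)" by simp
  then have Bc: "B c = - (of_real t * cnj c)"
    by (simp add: neg_eq_iff_add_eq_0 eq_neg_iff_add_eq_0)
  have near: "cmod (of_real t * cnj c + A z) \<le> l * cmod (z - c)" if "z \<in> ball 0 1" for z
    using lipschitz_onD[OF lipB, of z c] that c(1) BA[OF that] Bc by (simp add: dist_norm add.commute)
  have "t = 1"
  proof (rule ccontr)
    assume "t \<noteq> 1"
    then have t: "t > 1" using t1 by simp
    then have "cmod (B c) = t" by (auto simp: t_def max_def split: if_splits)
    then have c1: "cmod c = 1" using t by (simp add: Bc norm_mult)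
    then have cc: "c * cnj c = 1" using complex_norm_square[of c] by simp
    \<comment> \<open>Now \<open>1 + z A z\<close> is compared with \<open>1 - t cnj c z\<close>, whose zero \<open>c / t\<close> lies in the disc. The bound
      \<open>2 / (t + 1) < R\<close> is what makes \<open>|z - c| < |1 - t cnj c z|\<close> hold on the whole circle of radius \<open>R\<close>.\<close>
    have "2 / (t + 1) < 1" using t by simp
    then obtain R where R: "2 / (t + 1) < R" "R < 1" using dense by blast
    have R0: "R > 0" using R(1) t by (smt (verit) divide_pos_pos)
    have Rt: "2 < R * (t + 1)" using R(1) t by (simp add: pos_divide_less_eq)
    have tR: "1 / t < R"
    proof -
      have "1 / t < 2 / (t + 1)" using t by (simp add: field_simps)
      then show ?thesis using R by simp
    qed
    define F where "F z = (1 - of_real t * cnj c * z) / (1 + z * A z)" for z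
    have holF: "F holomorphic_on ball 0 1"
      unfolding F_def by (intro holomorphic_intros hol nz)
    \<comment> \<open>If \<open>|p - a| < |a|\<close> then \<open>Re (a / p) > 1/2\<close>. By the maximum principle the bound \<open>Re F \<ge> 1/2\<close> passes from the
      circle to its interior, where it contradicts \<open>F (c / t) = 0\<close>.\<close>
    have "Re (- F (c / of_real t)) \<le> - (1 / 2)"
    proof (rule maximum_real_frontier[of "\<lambda>z. - F z" "ball 0 R"])
      show "(\<lambda>z. - F z) holomorphic_on interior (ball 0 R)"
        using R by (auto intro!: holomorphic_intros intro: holomorphic_on_subset[OF holF])
      show "continuous_on (closure (ball 0 R)) (\<lambda>z. - F z)"
        using R R0 by (intro holomorphic_on_imp_continuous_on holomorphic_on_minus
            holomorphic_on_subset[OF holF]) auto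
      show "c / of_real t \<in> ball 0 R" using tR c1 t by (simp add: norm_divide)
      fix z :: complex assume "z \<in> frontier (ball 0 R)"
      then have z: "cmod z = R" using R0 by (simp add: frontier_ball)
      then have zb: "z \<in> ball 0 1" using R by simp
      define a where "a = 1 - of_real t * cnj c * z"
      define p where "p = 1 + z * A z"
      have p0: "p \<noteq> 0" using nz[OF zb] by (simp add: p_def)
      have "p - a = z * (of_real t * cnj c + A z)" by (simp add: p_def a_def algebra_simps)
      then have "cmod (p - a) = R * cmod (of_real t * cnj c + A z)" by (simp add: norm_mult z)
      also have "\<dots> \<le> 1 * (1 * cmod (z - c))"
      proof (intro mult_mono)
        show "cmod (of_real t * cnj c + A z) \<le> 1 * cmod (z - c)"
          using near[OF zb] mult_right_mono[OF l, of "cmod (z - c)"] by simp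
      qed (use R R0 in auto)
      finally have pa: "cmod (p - a) \<le> cmod (z - c)" by simp
      define x where "x = Re (cnj c * z)"
      have xR: "x \<le> R" using complex_Re_le_cmod[of "cnj c * z"] by (simp add: x_def norm_mult z c1)
      have zc: "(cmod (z - c))\<^sup>2 = R\<^sup>2 - 2 * x + 1"
      proof -
        have "(cmod (z - c))\<^sup>2 = (cmod z)\<^sup>2 - 2 * x + (cmod c)\<^sup>2"
          unfolding cmod_power2 x_def by (simp add: power2_eq_square algebra_simps)
        then show ?thesis by (simp add: z c1)
      qed
      have aa: "(cmod a)\<^sup>2 = 1 - 2 * t * x + t\<^sup>2 * R\<^sup>2"
      proof -
        have "(cmod a)\<^sup>2 = 1 - 2 * t * x + t\<^sup>2 * (cmod (cnj c * z))\<^sup>2"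
          unfolding cmod_power2 x_def a_def by (simp add: power2_eq_square algebra_simps)
        then show ?thesis by (simp add: norm_mult z c1)
      qed
      have "(cmod a)\<^sup>2 - (cmod (z - c))\<^sup>2 = (t - 1) * (R * (R * (t + 1)) - 2 * x)"
        unfolding zc aa by (simp add: power2_eq_square algebra_simps)
      moreover have "R * (R * (t + 1)) - 2 * x > 0"
        using mult_strict_left_mono[OF Rt R0] xR by simp
      ultimately have "(cmod (z - c))\<^sup>2 < (cmod a)\<^sup>2" using t
        by (metis diff_gt_0_iff_gt mult_pos_pos)
      then have "(cmod (p - a))\<^sup>2 < (cmod a)\<^sup>2" using pa
        by (meson norm_ge_zero order_le_less_trans power_mono)
      moreover have "(cmod (p - a))\<^sup>2 = (cmod p)\<^sup>2 + (cmod a)\<^sup>2 - 2 * Re (a * cnj p)"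
        unfolding cmod_power2 by (simp add: power2_eq_square algebra_simps)
      ultimately have "(cmod p)\<^sup>2 \<le> 2 * Re (a * cnj p)" by simp
      moreover have "Re (F z) = Re (a * cnj p) / (cmod p)\<^sup>2"
        unfolding F_def a_def[symmetric] p_def[symmetric]
        by (subst complex_div_cnj) (simp flip: of_real_power)
      ultimately show "Re (- F z) \<le> - (1 / 2)"
        using p0 by (simp add: pos_le_divide_eq)
    qed simp
    moreover have "F (c / of_real t) = 0" using cc t by (simp add: F_def mult.commute)
    ultimately show False by simp
  qed
  with near c(1) show thesis by (intro that[of c]) auto
qed

text \<open>
  With \<open>c\<close> from the previous lemma, \<open>1 + z A z = (1 - cnj c z) + z (cnj c + A z)\<close>. The last term is at most
  \<open>l |z| |z - c|\<close>, and \<open>|z - c| \<le> |1 - cnj c z|\<close> in the unit disc, so dividing by \<open>1 - cnj c z\<close>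
  leaves \<open>l\<close> times a function bounded by \<open>|z|\<close>. In the statement \<open>c\<close> stands for \<open>cnj c\<close>.
\<close>
lemma zero_free_lipschitz_factorization:
  fixes A :: "complex \<Rightarrow> complex"
  assumes hol: "A holomorphic_on ball 0 1" and lip: "l-lipschitz_on (ball 0 1) A" and l: "0 < l" "l \<le> 1"
    and nz: "\<And>z. z \<in> ball 0 1 \<Longrightarrow> 1 + z * A z \<noteq> 0"
  obtains c \<omega> where "cmod c \<le> 1" "\<omega> holomorphic_on ball 0 1"
    "\<And>z. z \<in> ball 0 1 \<Longrightarrow> cmod (\<omega> z) \<le> cmod z"
    "\<And>z. z \<in> ball 0 1 \<Longrightarrow> 1 + z * A z = (1 - c * z) * (1 - of_real l * \<omega> z)"
proof -
  obtain c where c: "cmod c \<le> 1" 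
    and near: "\<And>z. z \<in> ball 0 1 \<Longrightarrow> cmod (cnj c + A z) \<le> l * cmod (z - c)"
    using zero_free_lipschitz_reflected_fixed_point[OF hol lip l(2) nz] by blast
  define \<omega> where "\<omega> z = - (z * (cnj c + A z)) / (of_real l * (1 - cnj c * z))" for z
  have d: "1 - cnj c * z \<noteq> 0" if "z \<in> ball 0 1" for z
  proof
    assume "1 - cnj c * z = 0"
    then have "cmod (cnj c * z) = 1" by simp
    moreover have "cmod (cnj c * z) \<le> 1 * cmod z"
      unfolding norm_mult by (intro mult_right_mono) (use c in auto)
    ultimately show False using that by simp
  qed
  show thesis
  proof (rule that[of "cnj c" \<omega>])
    show "\<omega> holomorphic_on ball 0 1"
      unfolding \<omega>_def using d l by (intro holomorphic_intros hol) auto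
    fix z :: complex assume z: "z \<in> ball 0 1"
    show "1 + z * A z = (1 - cnj c * z) * (1 - of_real l * \<omega> z)"
    proof -
      have "of_real l * \<omega> z = - (z * (cnj c + A z)) / (1 - cnj c * z)"
        using l by (simp add: \<omega>_def)
      then have "(1 - cnj c * z) * (of_real l * \<omega> z) = - (z * (cnj c + A z))"
        using d[OF z] by simp
      then show ?thesis by (simp add: algebra_simps)
    qed
    have "(cmod (1 - cnj c * z))\<^sup>2 - (cmod (z - c))\<^sup>2 = (1 - (cmod c)\<^sup>2) * (1 - (cmod z)\<^sup>2)"
      unfolding cmod_power2 by (simp add: power2_eq_square algebra_simps)
    moreover have "\<dots> \<ge> 0" using c z by (intro mult_nonneg_nonneg) (auto simp: power_le_one)
    ultimately have "(cmod (z - c))\<^sup>2 \<le> (cmod (1 - cnj c * z))\<^sup>2" by linarith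
    then have "cmod (z - c) \<le> cmod (1 - cnj c * z)" by (rule power2_le_imp_le) simp
    then have "l * cmod (z - c) \<le> l * cmod (1 - cnj c * z)" using l by simp
    with near[OF z] have "cmod (cnj c + A z) \<le> l * cmod (1 - cnj c * z)" by linarith
    then have "cmod z * cmod (cnj c + A z) \<le> cmod z * (l * cmod (1 - cnj c * z))"
      by (intro mult_left_mono) auto
    then show "cmod (\<omega> z) \<le> cmod z"
      using d[OF z] l by (simp add: \<omega>_def norm_divide norm_mult pos_divide_le_eq)
  qed (use c in auto)
qed

section \<open>Littlewood's subordination principle for hinge functions\<close>

abbreviation (input) circle_point :: "real \<Rightarrow> real \<Rightarrow> complex" where
  "circle_point r t \<equiv> complex_of_real r * exp (\<i> * complex_of_real t)"

lemma norm_circle_point: "0 \<le> r \<Longrightarrow> cmod (circle_point r t) = r"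
  by (simp add: norm_mult)

lemma has_integral_periodic_recentre:
  fixes g :: "real \<Rightarrow> complex"
  assumes g: "(g has_integral I) {0..2*pi}" and per: "\<And>t. g (2*pi + t) = g t"
  shows "(g has_integral I) {-pi..pi}"
proof -
  have "g integrable_on {0..2*pi}" using g by blast
  then have i1: "g integrable_on {0..pi}" and i2: "g integrable_on {pi..2*pi}"
    by (auto elim!: integrable_subinterval_real)
  have I: "integral {0..pi} g + integral {pi..2*pi} g = I"
    using Henstock_Kurzweil_Integration.integral_combine[where f=g and a=0 and b="2*pi" and c=pi] g by (auto simp: integral_unique has_integral_integrable)
  have "((g \<circ> (+) (2*pi)) has_integral integral {pi..2*pi} g) {-pi..0}"
    unfolding has_integral_shift_Icc_real using i2 by (simp add: integrable_integral)
  moreover have "g \<circ> (+) (2*pi) = g" using per by auto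
  ultimately have "(g has_integral integral {pi..2*pi} g + integral {0..pi} g) {-pi..pi}"
    using i1 by (intro has_integral_combine[of _ 0]) (auto simp: integrable_integral)
  then show ?thesis using I by (simp add: add.commute)
qed

text \<open>
  Cauchy's integral formula written as an integral over the angle; for \<open>w = 0\<close> it is the mean value
  property, and it also produces the Poisson formula below.
\<close>
lemma has_integral_cauchy_circle:
  assumes hol: "F holomorphic_on cball 0 r" and w: "cmod w < r"
  shows "((\<lambda>t. F (circle_point r t) * circle_point r t / (circle_point r t - w))
     has_integral 2 * of_real pi * F w) {-pi..pi}"
proof (rule has_integral_periodic_recentre)
  have "((\<lambda>u. F u / (u - w)) has_contour_integral (2 * of_real pi * \<i> * F w)) (part_circlepath 0 r 0 (2*pi))"
    using Cauchy_integral_circlepath_simple[OF hol] w by (simp add: circlepath_def)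
  then have "((\<lambda>t. F (circle_point r t) / (circle_point r t - w) * of_real r * \<i> * exp (\<i> * of_real t))
      has_integral (2 * of_real pi * \<i> * F w)) {0..2*pi}"
    by (subst (asm) has_contour_integral_part_circlepath_iff) (simp_all add: cis_conv_exp)
  from has_integral_mult_right[OF this, of "-\<i>"]
  show "((\<lambda>t. F (circle_point r t) * circle_point r t / (circle_point r t - w))
     has_integral 2 * of_real pi * F w) {0..2*pi}"
    by (rule has_integral_eq_rhs[OF has_integral_eq, rotated]) (auto simp: field_simps)
  have "exp (\<i> * complex_of_real (2*pi + t)) = exp (\<i> * complex_of_real t)" for t
    by (simp add: distrib_left exp_add exp_eq_1)
  then show "F (circle_point r (2*pi + t)) * circle_point r (2*pi + t) / (circle_point r (2*pi + t) - w)
      = F (circle_point r t) * circle_point r t / (circle_point r t - w)" for t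
    by (simp only:)
qed

definition poisson :: "real \<Rightarrow> complex \<Rightarrow> real \<Rightarrow> real" where
  "poisson r w t = (r\<^sup>2 - (cmod w)\<^sup>2) / (cmod (circle_point r t - w))\<^sup>2"

lemma poisson_nonneg: "cmod w < r \<Longrightarrow> 0 \<le> poisson r w t"
  by (simp add: poisson_def power_mono)

lemma circle_point_neq: "cmod w < r \<Longrightarrow> circle_point r t \<noteq> w"
  using norm_circle_point[of r t] norm_ge_zero[of w] by (metis le_less_trans less_irrefl less_imp_le)

text \<open>
  Being the real part of a holomorphic function of \<open>w\<close>, the kernel satisfies the mean value property
  in \<open>w\<close>, also after substitution of a holomorphic function for \<open>w\<close>.
\<close>
lemma poisson_eq_Re:
  assumes "cmod w < r"
  shows "poisson r w t = Re ((circle_point r t + w) / (circle_point r t - w))"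
proof -
  define z where "z = circle_point r t"
  have z: "cmod z = r" using assms norm_ge_zero[of w] unfolding z_def by (intro norm_circle_point) linarith
  have "Re ((z + w) / (z - w)) = Re ((z + w) * cnj (z - w)) / (cmod (z - w))\<^sup>2"
    by (subst complex_div_cnj) (simp flip: of_real_power)
  also have "Re ((z + w) * cnj (z - w)) = (cmod z)\<^sup>2 - (cmod w)\<^sup>2"
    unfolding cmod_power2 by (simp add: power2_eq_square algebra_simps)
  finally show ?thesis by (simp add: poisson_def z z_def[symmetric])
qed

lemma has_integral_poisson:
  assumes hol: "h holomorphic_on cball 0 r" and w: "cmod w < r"
  shows "((\<lambda>t. Re (h (circle_point r t)) * poisson r w t) has_integral 2 * pi * Re (h w)) {-pi..pi}"
proof -
  have r0: "r > 0" using w norm_ge_zero[of w] by linarith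
  have nz: "of_real (r\<^sup>2) - cnj w * z \<noteq> 0" if "cmod z \<le> r" for z
  proof
    assume "of_real (r\<^sup>2) - cnj w * z = 0"
    then have "cmod (cnj w * z) = r\<^sup>2" using r0 by (metis eq_iff_diff_eq_0 norm_of_real abs_of_nonneg zero_le_power2)
    moreover have "cmod w * cmod z \<le> cmod w * r" using that by (intro mult_left_mono) auto
    moreover have "cmod w * r < r * r" using w r0 by simp
    ultimately show False by (simp add: norm_mult power2_eq_square)
  qed
  \<comment> \<open>\<open>F\<close> agrees with \<open>h\<close> at \<open>w\<close>, and the extra factor turns the Cauchy kernel on the circle into the
    Poisson kernel.\<close>
  define F where "F z = h z * (of_real (r\<^sup>2) - cnj w * w) / (of_real (r\<^sup>2) - cnj w * z)" for z
  have "F holomorphic_on cball 0 r"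
    unfolding F_def using nz by (intro holomorphic_intros hol) auto
  from has_integral_cauchy_circle[OF this w]
  have "((\<lambda>t. F (circle_point r t) * circle_point r t / (circle_point r t - w))
      has_integral 2 * of_real pi * h w) {-pi..pi}"
    using nz[of w] w by (simp add: F_def)
  from has_integral_linear[OF this bounded_linear_Re]
  have *: "((\<lambda>t. Re (F (circle_point r t) * circle_point r t / (circle_point r t - w)))
      has_integral 2 * pi * Re (h w)) {-pi..pi}"
    by (simp add: o_def)
  show ?thesis
  proof (rule has_integral_eq[OF _ *])
    fix t
    define z where "z = circle_point r t"
    have z: "cmod z = r" unfolding z_def using r0 by (intro norm_circle_point) simp
    have zw: "z - w \<noteq> 0" using circle_point_neq[OF w] by (simp add: z_def)
    have z0: "z \<noteq> 0" using z r0 by auto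
    have den: "of_real (r\<^sup>2) - cnj w * z = z * cnj (z - w)"
      using complex_norm_square[of z] z by (simp add: algebra_simps)
    have num: "of_real (r\<^sup>2) - cnj w * w = complex_of_real (r\<^sup>2 - (cmod w)\<^sup>2)"
      using complex_norm_square[of w] by (simp add: mult.commute)
    have "F z * z / (z - w) = h z * of_real (r\<^sup>2 - (cmod w)\<^sup>2) / ((z - w) * cnj (z - w))"
    proof -
      define D where "D = cnj (z - w)"
      show ?thesis unfolding F_def den num D_def[symmetric] using z0 by simp
    qed
    also have "\<dots> = h z * of_real (poisson r w t)"
      unfolding complex_norm_square[symmetric] poisson_def z_def[symmetric] by simp
    finally show "Re (F (circle_point r t) * circle_point r t / (circle_point r t - w))
        = Re (h (circle_point r t)) * poisson r w t"
      by (simp add: z_def)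
  qed
qed

lemma has_integral_poisson_Schwarz:
  assumes hol: "\<eta> holomorphic_on cball 0 r" and r: "0 < r" and \<eta>0: "\<eta> 0 = 0"
    and less: "\<And>z. z \<in> cball 0 r \<Longrightarrow> cmod (\<eta> z) < r"
  shows "((\<lambda>\<theta>. poisson r (\<eta> (circle_point r \<theta>)) t) has_integral 2 * pi) {-pi..pi}"
proof -
  define K where "K z = (circle_point r t + \<eta> z) / (circle_point r t - \<eta> z)" for z
  have "K holomorphic_on cball 0 r"
    unfolding K_def using circle_point_neq[OF less] by (intro holomorphic_intros hol) auto
  from has_integral_cauchy_circle[OF this, of 0] 
  have "((\<lambda>\<theta>. K (circle_point r \<theta>)) has_integral 2 * of_real pi) {-pi..pi}"
    using r by (simp add: K_def \<eta>0)
  from has_integral_linear[OF this bounded_linear_Re]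
  have *: "((\<lambda>\<theta>. Re (K (circle_point r \<theta>))) has_integral 2 * pi) {-pi..pi}"
    by (simp add: o_def)
  show ?thesis
    by (rule has_integral_eq[OF _ *])
      (use r less in \<open>simp add: K_def poisson_eq_Re norm_mult\<close>)
qed

text \<open>
  The Poisson formula for \<open>Re h\<close> at \<open>\<eta> z\<close> bounds the hinge of \<open>Re h\<close> at \<open>\<eta> z\<close> by the Poisson average of the
  hinge over the circle, as the kernel is a probability density up to the factor \<open>2 * pi\<close>. Averaging
  over \<open>z\<close> and exchanging the integrals, the kernel averages out to its value at \<open>\<eta> 0 = 0\<close>, which is
  constant on the circle. Strictness of \<open>|\<eta> z| < r\<close> keeps \<open>\<eta> z\<close> off the circle, where the kernel
  is singular.
\<close>
lemma Littlewood_hinge_strict: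
  assumes h: "h holomorphic_on cball 0 r" and hol: "\<eta> holomorphic_on cball 0 r" and r: "0 < r" and \<eta>0: "\<eta> 0 = 0"
    and less: "\<And>z. z \<in> cball 0 r \<Longrightarrow> cmod (\<eta> z) < r"
  shows "integral {-pi..pi} (\<lambda>\<theta>. max 0 (Re (h (\<eta> (circle_point r \<theta>))) - k))
      \<le> integral {-pi..pi} (\<lambda>t. max 0 (Re (h (circle_point r t)) - k))"
proof -
  define H where "H t = max 0 (Re (h (circle_point r t)) - k)" for t
  define P where "P \<theta> t = poisson r (\<eta> (circle_point r \<theta>)) t" for \<theta> t
  have mem: "circle_point r \<theta> \<in> cball 0 r" for \<theta>
    using r by (simp add: norm_mult)
  have less': "cmod (\<eta> (circle_point r \<theta>)) < r" for \<theta> using less[OF mem] .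
  have cont\<eta>: "continuous_on S (\<lambda>x. \<eta> (circle_point r (g x)))"
    if "continuous_on S g" for S and g :: "'a::topological_space \<Rightarrow> real"
    by (rule continuous_on_compose2[OF holomorphic_on_imp_continuous_on[OF hol]])
      (intro continuous_intros that, use mem in auto)
  have conth: "continuous_on S (\<lambda>x. h (circle_point r (g x)))"
    if "continuous_on S g" for S and g :: "'a::topological_space \<Rightarrow> real"
    by (rule continuous_on_compose2[OF holomorphic_on_imp_continuous_on[OF h]])
      (intro continuous_intros that, use mem in auto)
  have conth\<eta>: "continuous_on S (\<lambda>x. h (\<eta> (circle_point r x)))" for S
    by (rule continuous_on_compose2[OF holomorphic_on_imp_continuous_on[OF h] cont\<eta>])
      (use less_imp_le[OF less'] in \<open>auto intro: continuous_intros\<close>)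
  have contH: "continuous_on S (\<lambda>x. H (g x))"
    if "continuous_on S g" for S and g :: "'a::topological_space \<Rightarrow> real"
    unfolding H_def by (intro continuous_intros conth that)
  have contP: "continuous_on S (\<lambda>x. P (g x) (k x))"
    if "continuous_on S g" "continuous_on S k" for S and g k :: "'a::topological_space \<Rightarrow> real"
    unfolding P_def poisson_def using circle_point_neq[OF less']
    by (intro continuous_intros cont\<eta> that) auto
  have point: "2 * pi * max 0 (Re (h (\<eta> (circle_point r \<theta>))) - k) \<le> integral {-pi..pi} (\<lambda>t. H t * P \<theta> t)" for \<theta>
  proof -
    have int: "(\<lambda>t. H t * P \<theta> t) integrable_on {-pi..pi}"
      by (intro integrable_continuous_real continuous_intros contH contP)
    have P0: "P \<theta> t \<ge> 0" for t unfolding P_def by (rule poisson_nonneg[OF less'])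
    have "((\<lambda>t. Re (h (circle_point r t)) * P \<theta> t - k * P \<theta> t) has_integral
        2 * pi * Re (h (\<eta> (circle_point r \<theta>))) - k * (2 * pi)) {-pi..pi}"
      using has_integral_poisson[OF holomorphic_on_const[of 1] less', of \<theta>]
      unfolding P_def
      by (intro has_integral_diff has_integral_mult_right has_integral_poisson h less') simp
    then have "2 * pi * Re (h (\<eta> (circle_point r \<theta>))) - k * (2 * pi) \<le> integral {-pi..pi} (\<lambda>t. H t * P \<theta> t)"
    proof (rule has_integral_le[OF _ integrable_integral[OF int]])
      fix t
      have "(Re (h (circle_point r t)) - k) * P \<theta> t \<le> H t * P \<theta> t"
        by (intro mult_right_mono P0) (simp add: H_def)
      then show "Re (h (circle_point r t)) * P \<theta> t - k * P \<theta> t \<le> H t * P \<theta> t"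
        by (simp add: algebra_simps)
    qed
    moreover have "0 \<le> integral {-pi..pi} (\<lambda>t. H t * P \<theta> t)"
      by (intro integral_nonneg int mult_nonneg_nonneg P0) (simp add: H_def)
    ultimately show ?thesis by (simp add: max_def algebra_simps)
  qed
  have swap: "integral {-pi..pi} (\<lambda>\<theta>. integral {-pi..pi} (\<lambda>t. H t * P \<theta> t))
      = integral {-pi..pi} (\<lambda>t. integral {-pi..pi} (\<lambda>\<theta>. H t * P \<theta> t))"
    using integral_swap_continuous[of "-pi" "-pi" pi pi "\<lambda>\<theta> t. H t * P \<theta> t"]
    by (simp add: split_beta contH contP continuous_intros)
  have "2 * pi * integral {-pi..pi} (\<lambda>\<theta>. max 0 (Re (h (\<eta> (circle_point r \<theta>))) - k))
      = integral {-pi..pi} (\<lambda>\<theta>. 2 * pi * max 0 (Re (h (\<eta> (circle_point r \<theta>))) - k))"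
    by simp
  also have "\<dots> \<le> integral {-pi..pi} (\<lambda>\<theta>. integral {-pi..pi} (\<lambda>t. H t * P \<theta> t))"
  proof (rule integral_le)
    show "(\<lambda>\<theta>. 2 * pi * max 0 (Re (h (\<eta> (circle_point r \<theta>))) - k)) integrable_on {-pi..pi}"
      by (intro integrable_continuous_real continuous_intros conth\<eta>)
    have "continuous_on {-pi..pi} (\<lambda>\<theta>. integral (cbox (-pi) pi) (\<lambda>t. H t * P \<theta> t))"
      by (rule integral_continuous_on_param) (simp add: split_beta contH contP continuous_intros)
    then show "(\<lambda>\<theta>. integral {-pi..pi} (\<lambda>t. H t * P \<theta> t)) integrable_on {-pi..pi}"
      by (intro integrable_continuous_real) simp
  qed (rule point)
  also note swap
  also have "integral {-pi..pi} (\<lambda>t. integral {-pi..pi} (\<lambda>\<theta>. H t * P \<theta> t)) = integral {-pi..pi} (\<lambda>t. 2 * pi * H t)"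
  proof (rule integral_cong)
    fix t
    have "integral {-pi..pi} (\<lambda>\<theta>. P \<theta> t) = 2 * pi"
      unfolding P_def using has_integral_poisson_Schwarz[OF hol r \<eta>0 less] by (intro integral_unique)
    then show "integral {-pi..pi} (\<lambda>\<theta>. H t * P \<theta> t) = 2 * pi * H t" by simp
  qed
  also have "\<dots> = 2 * pi * integral {-pi..pi} H" by simp
  finally show ?thesis by (simp add: H_def[abs_def])
qed

text \<open>
  The strict version applies to \<open>s \<omega>\<close> for \<open>s < 1\<close>, and the resulting left-hand side is continuous in \<open>s\<close> up to \<open>s = 1\<close>.
\<close>
lemma Littlewood_hinge:
  assumes h: "h holomorphic_on ball 0 1" and hol: "\<omega> holomorphic_on ball 0 1" and r: "0 < r" "r < 1"
    and le: "\<And>z. z \<in> ball 0 1 \<Longrightarrow> cmod (\<omega> z) \<le> cmod z"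
  shows "integral {-pi..pi} (\<lambda>\<theta>. max 0 (Re (h (\<omega> (circle_point r \<theta>))) - k))
      \<le> integral {-pi..pi} (\<lambda>t. max 0 (Re (h (circle_point r t)) - k))"
proof -
  have sub: "cball 0 r \<subseteq> ball (0::complex) 1" using r by auto
  define J where "J s = integral {-pi..pi} (\<lambda>\<theta>. max 0 (Re (h (of_real s * \<omega> (circle_point r \<theta>))) - k))" for s
  have mem: "circle_point r \<theta> \<in> ball 0 1" for \<theta> using r by (simp add: norm_mult)
  have cont: "continuous_on {0..1} J"
  proof -
    have "continuous_on ({0..1} \<times> cbox (-pi) pi) (\<lambda>x. h (of_real (fst x) * \<omega> (circle_point r (snd x))))"
    proof (rule continuous_on_compose2[OF holomorphic_on_imp_continuous_on[OF h]])
      have "continuous_on ({0..1::real} \<times> cbox (-pi) pi) (\<lambda>x. \<omega> (circle_point r (snd x)))"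
        by (rule continuous_on_compose2[OF holomorphic_on_imp_continuous_on[OF hol]])
          (intro continuous_intros, use mem in auto)
      then show "continuous_on ({0..1} \<times> cbox (-pi) pi) (\<lambda>x. of_real (fst x) * \<omega> (circle_point r (snd x)))"
        by (intro continuous_intros)
      show "(\<lambda>x. of_real (fst x) * \<omega> (circle_point r (snd x))) ` ({0..1} \<times> cbox (-pi) pi) \<subseteq> ball 0 1"
      proof clarsimp
        fix s \<theta> :: real assume s: "0 \<le> s" "s \<le> 1"
        have "s * cmod (\<omega> (circle_point r \<theta>)) \<le> 1 * cmod (circle_point r \<theta>)"
          using s by (intro mult_mono le mem) auto
        then show "cmod (of_real s * \<omega> (circle_point r \<theta>)) < 1"
          using s r by (simp add: norm_mult)
      qed
    qed
    then have "continuous_on {0..1} (\<lambda>s. integral (cbox (-pi) pi) (\<lambda>\<theta>. max 0 (Re (h (of_real s * \<omega> (circle_point r \<theta>))) - k)))"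
      by (intro integral_continuous_on_param) (auto simp: split_beta intro!: continuous_intros)
    then show ?thesis by (simp add: J_def)
  qed
  have "J 1 \<le> integral {-pi..pi} (\<lambda>t. max 0 (Re (h (circle_point r t)) - k))"
  proof (rule continuous_le_on_closure[of "{0<..<1}" J])
    show "continuous_on (closure {0<..<1}) J" "1 \<in> closure {0<..<1::real}" using cont by auto
    fix s :: real assume s: "s \<in> {0<..<1}"
    have "cmod (of_real s * \<omega> z) < r" if z: "z \<in> cball 0 r" for z
    proof -
      have "cmod (\<omega> z) \<le> r" using le[of z] z sub by force
      then have "s * cmod (\<omega> z) \<le> s * r" using s by simp
      also have "\<dots> < r" using s r by simp
      finally show ?thesis using s by (simp add: norm_mult)
    qed
    moreover have "\<omega> 0 = 0" using le[of 0] by simp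
    ultimately show "J s \<le> integral {-pi..pi} (\<lambda>t. max 0 (Re (h (circle_point r t)) - k))"
      unfolding J_def using r sub
      by (intro Littlewood_hinge_strict[of h r "\<lambda>z. of_real s * \<omega> z"])
        (auto intro!: holomorphic_intros intro: holomorphic_on_subset[OF h] holomorphic_on_subset[OF hol])
  qed
  then show ?thesis by (simp add: J_def)
qed

section \<open>From hinge functions to convex functions and comonotone sums\<close>

text \<open>
  On a fine equidistant grid of \<open>{m..M}\<close>, the piecewise linear interpolation of \<open>\<Phi>\<close>, continued by the
  constant \<open>\<Phi> m\<close> to the left, is \<open>\<Phi> m\<close> plus hinges at the grid points whose coefficients, the
  successive increases of slope, are nonnegative; the first one is so because \<open>\<Phi>\<close> is nondecreasing.
  Hence the inequality holds for the interpolation, which dominates \<open>\<Phi>\<close> on \<open>{..M}\<close> by convexity and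
  monotonicity and exceeds it by at most \<open>e\<close> on \<open>{m..M}\<close>.
\<close>
lemma integral_convex_mono_le_of_hinge:
  fixes u U \<Phi> :: "real \<Rightarrow> real"
  assumes cvx: "convex_on UNIV \<Phi>" and mono: "mono \<Phi>" and mM: "m < M" and ab: "a \<le> b"
    and contu: "continuous_on {a..b} u" and contU: "continuous_on {a..b} U"
    and u_le: "\<And>x. x \<in> {a..b} \<Longrightarrow> u x \<le> M" and U_in: "\<And>x. x \<in> {a..b} \<Longrightarrow> U x \<in> {m..M}"
    and hinge: "\<And>k. k \<in> {m..M} \<Longrightarrow>
      integral {a..b} (\<lambda>x. max 0 (u x - k)) \<le> integral {a..b} (\<lambda>x. max 0 (U x - k))"
  shows "integral {a..b} (\<lambda>x. \<Phi> (u x)) \<le> integral {a..b} (\<lambda>x. \<Phi> (U x))"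
proof -
  have cont: "continuous_on S \<Phi>" for S
    using convex_on_continuous[OF open_UNIV cvx] continuous_on_subset by blast
  have int: "(\<lambda>x. \<psi> (v x)) integrable_on {a..b}"
    if "continuous_on UNIV \<psi>" "continuous_on {a..b} v" for \<psi> v :: "real \<Rightarrow> real"
    by (rule integrable_continuous_real, rule continuous_on_compose2[OF that]) auto
  have main: "integral {a..b} (\<lambda>x. \<Phi> (u x)) \<le> integral {a..b} (\<lambda>x. \<Phi> (U x)) + e * (b - a)"
    if e: "e > 0" for e :: real
  proof -
    have "uniformly_continuous_on {m..M} \<Phi>"
      by (rule compact_uniformly_continuous[OF cont]) simp
    then obtain d where d: "d > 0"
      and dd: "\<And>x y. x \<in> {m..M} \<Longrightarrow> y \<in> {m..M} \<Longrightarrow> dist y x < d \<Longrightarrow> dist (\<Phi> y) (\<Phi> x) < e"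
      unfolding uniformly_continuous_on_def using e by blast
    obtain N :: nat where N: "(M - m) / d < real N"
      using reals_Archimedean2 by blast
    have N0: "N > 0"
    proof (rule ccontr)
      assume "\<not> N > 0"
      then show False using N d mM by (simp add: divide_less_eq)
    qed
    define h where "h = (M - m) / real N"
    have h0: "h > 0" using N0 mM by (simp add: h_def)
    have hd: "h < d" using N N0 d by (simp add: h_def divide_less_eq mult.commute)
    define X where "X n = m + real n * h" for n :: nat
    have XS: "X (Suc n) = X n + h" for n by (simp add: X_def algebra_simps)
    have XN: "X N = M" using N0 by (simp add: X_def h_def)
    have Xin: "X n \<in> {m..M}" if "n \<le> N" for n
    proof -
      have "real n * h \<le> real N * h" using that h0 by (simp add: mult_right_mono)
      then have "X n \<le> X N" by (simp add: X_def)
      moreover have "m \<le> X n" using h0 by (simp add: X_def)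
      ultimately show ?thesis using XN by simp
    qed
    \<comment> \<open>\<open>\<psi>\<close> interpolates up to the grid point \<open>X n\<close> and is affine with slope \<open>s\<close> beyond it. The last conjunct says
      that \<open>s\<close> does not exceed the slopes of \<open>\<Phi>\<close> to the right of \<open>X n\<close>, so that the next hinge gets a
      nonnegative coefficient.\<close>
    have "\<exists>\<psi> s. continuous_on UNIV \<psi>
        \<and> integral {a..b} (\<lambda>x. \<psi> (u x)) \<le> integral {a..b} (\<lambda>x. \<psi> (U x))
        \<and> (\<forall>x\<le>X n. \<Phi> x \<le> \<psi> x) \<and> (\<forall>x\<in>{m..X n}. \<psi> x \<le> \<Phi> x + e)
        \<and> (\<forall>x\<ge>X n. \<psi> x = \<Phi> (X n) + s * (x - X n))
        \<and> (\<forall>y\<ge>X n. s * (y - X n) \<le> \<Phi> y - \<Phi> (X n))" if "n \<le> N" for n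
      using that
    proof (induction n)
      case 0
      show ?case
        by (rule exI[of _ "\<lambda>x. \<Phi> m"], rule exI[of _ 0])
          (use e monoD[OF mono] in \<open>auto simp: X_def\<close>)
    next
      case (Suc n)
      have "n \<le> N" using Suc.prems by simp
      from Suc.IH[OF this] obtain \<psi> s where cont\<psi>: "continuous_on UNIV \<psi>"
        and int\<psi>: "integral {a..b} (\<lambda>x. \<psi> (u x)) \<le> integral {a..b} (\<lambda>x. \<psi> (U x))"
        and up: "\<And>x. x \<le> X n \<Longrightarrow> \<Phi> x \<le> \<psi> x"
        and lo: "\<And>x. x \<in> {m..X n} \<Longrightarrow> \<psi> x \<le> \<Phi> x + e"
        and right: "\<And>x. x \<ge> X n \<Longrightarrow> \<psi> x = \<Phi> (X n) + s * (x - X n)"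
        and supp: "\<And>y. y \<ge> X n \<Longrightarrow> s * (y - X n) \<le> \<Phi> y - \<Phi> (X n)"
        by blast
      define s' where "s' = (\<Phi> (X (Suc n)) - \<Phi> (X n)) / h"
      have s'h: "s' * h = \<Phi> (X (Suc n)) - \<Phi> (X n)" using h0 by (simp add: s'_def)
      have ss': "s \<le> s'"
        using supp[of "X (Suc n)"] h0 by (simp add: s'_def XS field_simps)
      define \<psi>' where "\<psi>' x = \<psi> x + (s' - s) * max 0 (x - X n)" for x
      have right': "\<psi>' x = \<Phi> (X n) + s' * (x - X n)" if "x \<ge> X n" for x
        using right[OF that] that by (simp add: \<psi>'_def algebra_simps)
      have left': "\<psi>' x = \<psi> x" if "x \<le> X n" for x
        using that by (simp add: \<psi>'_def)
      have 1: "continuous_on UNIV \<psi>'"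
        unfolding \<psi>'_def by (intro continuous_intros cont\<psi>)
      have eq: "integral {a..b} (\<lambda>x. \<psi>' (v x)) = integral {a..b} (\<lambda>x. \<psi> (v x))
          + (s' - s) * integral {a..b} (\<lambda>x. max 0 (v x - X n))"
        if "continuous_on {a..b} v" for v
      proof -
        have "(\<lambda>x. max 0 (v x - X n)) integrable_on {a..b}"
          by (rule int[OF _ that]) (intro continuous_intros)
        then show ?thesis unfolding \<psi>'_def
          using int[OF cont\<psi> that] by (subst integral_add) (auto intro!: integrable_on_mult_right)
      qed
      have "(s' - s) * integral {a..b} (\<lambda>x. max 0 (u x - X n))
          \<le> (s' - s) * integral {a..b} (\<lambda>x. max 0 (U x - X n))"
        using hinge[OF Xin] Suc.prems ss' by (intro mult_left_mono) auto
      then have 2: "integral {a..b} (\<lambda>x. \<psi>' (u x)) \<le> integral {a..b} (\<lambda>x. \<psi>' (U x))"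
        using int\<psi> by (simp add: eq contu contU)
      have 3: "\<Phi> x \<le> \<psi>' x" if "x \<le> X (Suc n)" for x
      proof (cases "x \<le> X n")
        case True then show ?thesis using up left' by simp
      next
        case False
        then have "x \<in> {X n..X (Suc n)}" using that by simp
        from convex_onD_Icc'[OF convex_on_subset[OF cvx] this]
        show ?thesis using False right' by (simp add: s'_def XS)
      qed
      have 4: "\<psi>' x \<le> \<Phi> x + e" if x: "x \<in> {m..X (Suc n)}" for x
      proof (cases "x \<le> X n")
        case True then show ?thesis using lo x left' by simp
      next
        case False
        have s'0: "s' \<ge> 0" using monoD[OF mono, of "X n" "X (Suc n)"] h0 by (simp add: s'_def XS)
        have "\<psi>' x = \<Phi> (X n) + s' * (x - X n)" using False right' by simp
        also have "\<dots> \<le> \<Phi> (X n) + s' * h"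
          using s'0 x by (simp add: XS mult_left_mono)
        also have "\<dots> = \<Phi> (X (Suc n))" by (simp add: s'h)
        also have "\<dots> \<le> \<Phi> (X n) + e"
          using dd[OF Xin Xin, of n "Suc n"] Suc.prems hd h0 by (simp add: dist_real_def XS)
        also have "\<dots> \<le> \<Phi> x + e" using monoD[OF mono, of "X n" x] False by simp
        finally show ?thesis .
      qed
      have 5: "\<psi>' x = \<Phi> (X (Suc n)) + s' * (x - X (Suc n))" if "x \<ge> X (Suc n)" for x
        using right'[of x] that h0 s'h by (simp add: XS algebra_simps)
      have 6: "s' * (y - X (Suc n)) \<le> \<Phi> y - \<Phi> (X (Suc n))" if "y \<ge> X (Suc n)" for y
      proof (cases "y = X (Suc n)")
        case False
        then have y: "X (Suc n) < y" "X n < X (Suc n)" using that h0 by (auto simp: XS)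
        from convex_on_slope_le[OF cvx, of "X n" y "X (Suc n)"] y
        have "(\<Phi> (X n) - \<Phi> (X (Suc n))) / (X n - X (Suc n)) \<le> (\<Phi> (X (Suc n)) - \<Phi> y) / (X (Suc n) - y)"
          by simp
        also have "(\<Phi> (X n) - \<Phi> (X (Suc n))) / (X n - X (Suc n)) = s'"
          using h0 by (simp add: s'_def XS field_simps)
        finally show ?thesis using y by (simp add: field_simps)
      qed simp
      show ?case
        by (rule exI[of _ \<psi>'], rule exI[of _ s']) (use 1 2 3 4 5 6 in auto)
    qed
    from this[of N] obtain \<psi> where cont\<psi>: "continuous_on UNIV \<psi>"
      and int\<psi>: "integral {a..b} (\<lambda>x. \<psi> (u x)) \<le> integral {a..b} (\<lambda>x. \<psi> (U x))"
      and up: "\<And>x. x \<le> M \<Longrightarrow> \<Phi> x \<le> \<psi> x"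
      and lo: "\<And>x. x \<in> {m..M} \<Longrightarrow> \<psi> x \<le> \<Phi> x + e"
      using XN by auto
    have "integral {a..b} (\<lambda>x. \<Phi> (u x)) \<le> integral {a..b} (\<lambda>x. \<psi> (u x))"
      using up u_le by (intro integral_le int contu cont cont\<psi>) auto
    also note int\<psi>
    also have "integral {a..b} (\<lambda>x. \<psi> (U x)) \<le> integral {a..b} (\<lambda>x. \<Phi> (U x) + e)"
      using lo U_in by (intro integral_le integrable_add int contU cont cont\<psi>) auto
    also have "\<dots> = integral {a..b} (\<lambda>x. \<Phi> (U x)) + e * (b - a)"
      using ab int[OF cont contU] by (subst integral_add) auto
    finally show ?thesis .
  qed
  show ?thesis
  proof (rule field_le_epsilon)
    fix e :: real assume "e > 0"
    with main[of "e / (b - a + 1)"] ab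
    have "integral {a..b} (\<lambda>x. \<Phi> (u x)) \<le> integral {a..b} (\<lambda>x. \<Phi> (U x)) + e / (b - a + 1) * (b - a)"
      by simp
    also have "e / (b - a + 1) * (b - a) \<le> e"
      using ab \<open>e > 0\<close> by (simp add: divide_simps algebra_simps)
    finally show "integral {a..b} (\<lambda>x. \<Phi> (u x)) \<le> integral {a..b} (\<lambda>x. \<Phi> (U x)) + e" by simp
  qed
qed

text \<open>
  For every level \<open>k = U1 c + U2 c\<close> one has
  \<open>max 0 (u1 + u2 - k) \<le> max 0 (u1 - U1 c) + max 0 (u2 - U2 c)\<close>, and the corresponding relation for
  \<open>U1\<close> and \<open>U2\<close> is an equality, since by comonotonicity \<open>U1 x - U1 c\<close> and \<open>U2 x - U2 c\<close> never have
  opposite signs. By the intermediate value theorem all levels between the extreme values of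
  \<open>U1 + U2\<close>, taken at \<open>p\<close> and \<open>q\<close>, are of this form.
\<close>
lemma integral_convex_mono_le_comonotone_sum:
  fixes u1 u2 U1 U2 \<Phi> :: "real \<Rightarrow> real"
  assumes cvx: "convex_on UNIV \<Phi>" and mono: "mono \<Phi>"
    and cont: "continuous_on {a..b} u1" "continuous_on {a..b} u2"
      "continuous_on {a..b} U1" "continuous_on {a..b} U2"
    and hinge1: "\<And>k. integral {a..b} (\<lambda>x. max 0 (u1 x - k)) \<le> integral {a..b} (\<lambda>x. max 0 (U1 x - k))"
    and hinge2: "\<And>k. integral {a..b} (\<lambda>x. max 0 (u2 x - k)) \<le> integral {a..b} (\<lambda>x. max 0 (U2 x - k))"
    and comonotone: "\<And>x y. x \<in> {a..b} \<Longrightarrow> y \<in> {a..b} \<Longrightarrow>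
      U1 x \<le> U1 y \<and> U2 x \<le> U2 y \<or> U1 y \<le> U1 x \<and> U2 y \<le> U2 x"
    and pq: "p \<in> {a..b}" "q \<in> {a..b}" "U1 p + U2 p < U1 q + U2 q"
    and range: "\<And>x. x \<in> {a..b} \<Longrightarrow> U1 p + U2 p \<le> U1 x + U2 x \<and> U1 x + U2 x \<le> U1 q + U2 q"
    and le1: "\<And>x. x \<in> {a..b} \<Longrightarrow> u1 x \<le> U1 q" and le2: "\<And>x. x \<in> {a..b} \<Longrightarrow> u2 x \<le> U2 q"
  shows "integral {a..b} (\<lambda>x. \<Phi> (u1 x + u2 x)) \<le> integral {a..b} (\<lambda>x. \<Phi> (U1 x + U2 x))"
proof (rule integral_convex_mono_le_of_hinge[OF cvx mono pq(3)])
  show "a \<le> b" using pq by simp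
  show "continuous_on {a..b} (\<lambda>x. u1 x + u2 x)" "continuous_on {a..b} (\<lambda>x. U1 x + U2 x)"
    by (intro continuous_intros cont)+
  show "u1 x + u2 x \<le> U1 q + U2 q" if "x \<in> {a..b}" for x
    using le1[OF that] le2[OF that] by simp
  show "U1 x + U2 x \<in> {U1 p + U2 p..U1 q + U2 q}" if "x \<in> {a..b}" for x
    using range[OF that] by simp
  fix k assume k: "k \<in> {U1 p + U2 p..U1 q + U2 q}"
  have "connected ((\<lambda>x. U1 x + U2 x) ` {a..b})"
    by (intro connected_continuous_image continuous_intros cont) simp
  then have "k \<in> (\<lambda>x. U1 x + U2 x) ` {a..b}"
    by (rule connectedD_interval[of _ "U1 p + U2 p" "U1 q + U2 q"]) (use pq k in auto)
  then obtain c where c: "c \<in> {a..b}" "k = U1 c + U2 c" by auto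
  have int: "(\<lambda>x. max 0 (v x - j)) integrable_on {a..b}" if "continuous_on {a..b} v" for v and j :: real
    by (intro integrable_continuous_real continuous_intros that)
  have "integral {a..b} (\<lambda>x. max 0 (u1 x + u2 x - k))
      \<le> integral {a..b} (\<lambda>x. max 0 (u1 x - U1 c) + max 0 (u2 x - U2 c))"
    by (intro integral_le integrable_add int continuous_intros cont) (auto simp: c)
  also have "\<dots> = integral {a..b} (\<lambda>x. max 0 (u1 x - U1 c)) + integral {a..b} (\<lambda>x. max 0 (u2 x - U2 c))"
    by (intro integral_add int cont)
  also have "\<dots> \<le> integral {a..b} (\<lambda>x. max 0 (U1 x - U1 c)) + integral {a..b} (\<lambda>x. max 0 (U2 x - U2 c))"
    by (intro add_mono hinge1 hinge2)
  also have "\<dots> = integral {a..b} (\<lambda>x. max 0 (U1 x - U1 c) + max 0 (U2 x - U2 c))"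
    by (intro integral_add[symmetric] int cont)
  also have "\<dots> = integral {a..b} (\<lambda>x. max 0 (U1 x + U2 x - k))"
  proof (rule integral_cong)
    fix x assume "x \<in> {a..b}"
    from comonotone[OF this c(1)]
    show "max 0 (U1 x - U1 c) + max 0 (U2 x - U2 c) = max 0 (U1 x + U2 x - k)"
      by (auto simp: c(2))
  qed
  finally show "integral {a..b} (\<lambda>x. max 0 (u1 x + u2 x - k)) \<le> integral {a..b} (\<lambda>x. max 0 (U1 x + U2 x - k))" .
qed

section \<open>Logarithms of products of two linear factors\<close>

lemma ln_norm_one_minus_bounds:
  assumes s: "0 \<le> s" "s \<le> 1" and w: "cmod w \<le> r" and r: "r < 1"
  shows "ln (1 - s * r) \<le> ln (cmod (1 - of_real s * w))" "ln (cmod (1 - of_real s * w)) \<le> ln (1 + s * r)"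
    and "1 - s * r > 0" "of_real s * w \<noteq> 1" "0 < Re (1 - of_real s * w)"
proof -
  have sw: "cmod (of_real s * w) \<le> s * r" using s w by (simp add: norm_mult mult_left_mono)
  have r0: "0 \<le> r" using w norm_ge_zero[of w] by linarith
  have "s * r \<le> 1 * r" using s r0 by (intro mult_right_mono) auto
  then show pos: "1 - s * r > 0" using r by simp
  have lo: "1 - s * r \<le> cmod (1 - of_real s * w)" 
    using norm_triangle_ineq2[of 1 "of_real s * w"] sw by simp
  have hi: "cmod (1 - of_real s * w) \<le> 1 + s * r"
    using norm_triangle_ineq4[of 1 "of_real s * w"] sw by simp
  show "ln (1 - s * r) \<le> ln (cmod (1 - of_real s * w))" "ln (cmod (1 - of_real s * w)) \<le> ln (1 + s * r)"
    using lo hi pos by (auto intro!: ln_mono)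
  show "of_real s * w \<noteq> 1" using lo pos by auto
  show "0 < Re (1 - of_real s * w)"
    using complex_Re_le_cmod[of "of_real s * w"] sw pos by simp
qed

text \<open>
  For \<open>0 \<le> s \<le> 1\<close> the function \<open>1 - s w\<close> has positive real part on the disc, so \<open>a ln |1 - s w|\<close> is the real part
  of the holomorphic function \<open>a Ln (1 - s w)\<close>. As \<open>a\<close> may be negative, both signs of the
  logarithm are covered.
\<close>
lemma Littlewood_hinge_log:
  fixes a s k :: real
  assumes s: "0 \<le> s" "s \<le> 1" and hol: "\<omega> holomorphic_on ball 0 1" and r: "0 < r" "r < 1"
    and le: "\<And>z. z \<in> ball 0 1 \<Longrightarrow> cmod (\<omega> z) \<le> cmod z"
  shows "integral {-pi..pi} (\<lambda>\<theta>. max 0 (a * ln (cmod (1 - of_real s * \<omega> (circle_point r \<theta>))) - k))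
      \<le> integral {-pi..pi} (\<lambda>\<theta>. max 0 (a * ln (cmod (1 - of_real s * circle_point r \<theta>)) - k))"
proof -
  define h where "h w = of_real a * Ln (1 - of_real s * w)" for w
  have Re: "0 < Re (1 - of_real s * w)" if "w \<in> ball 0 1" for w
    using ln_norm_one_minus_bounds(5)[OF s order_refl, of w] that by simp
  have hol_h: "h holomorphic_on ball 0 1"
    unfolding h_def
  proof (intro holomorphic_intros)
    fix w :: complex assume "w \<in> ball 0 1"
    from Re[OF this] show "1 - of_real s * w \<notin> \<real>\<^sub>\<le>\<^sub>0" by (auto simp: complex_nonpos_Reals_iff)
  qed
  have Re_h: "Re (h w) = a * ln (cmod (1 - of_real s * w))" if "w \<in> ball 0 1" for w
  proof -
    have "1 - of_real s * w \<noteq> 0" using Re[OF that] by force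
    then have "Re (Ln (1 - of_real s * w)) = ln (cmod (1 - of_real s * w))" by (rule Re_Ln)
    then show ?thesis by (simp add: h_def)
  qed
  have mem: "circle_point r \<theta> \<in> ball 0 1" for \<theta> using r by (simp add: norm_mult)
  then have mem': "\<omega> (circle_point r \<theta>) \<in> ball 0 1" for \<theta>
    using le[of "circle_point r \<theta>"] by (metis mem_ball_0 order_le_less_trans)
  from Littlewood_hinge[OF hol_h hol r le, of k]
  show ?thesis by (simp only: Re_h[OF mem] Re_h[OF mem'])
qed

text \<open>
  The order of the values of \<open>|1 - s z|\<close> on a circle is the reversed order of \<open>cos \<theta>\<close> for every \<open>s \<ge> 0\<close>; this is
  the source of comonotonicity.
\<close>
lemma norm_one_minus_circle_point_mono:
  assumes s: "0 \<le> s" "0 \<le> r" and cos: "cos x \<le> cos y"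
  shows "cmod (1 - of_real s * circle_point r y) \<le> cmod (1 - of_real s * circle_point r x)"
proof -
  have eq: "(cmod (1 - of_real s * circle_point r t))\<^sup>2 = 1 - 2 * (s * r) * cos t + (s * r)\<^sup>2" for t
  proof -
    have "(cmod (1 - of_real s * circle_point r t))\<^sup>2 = (1 - s * r * cos t)\<^sup>2 + (s * r * sin t)\<^sup>2"
      unfolding cmod_power2 by (simp add: Re_exp Im_exp mult.assoc)
    also have "\<dots> = 1 - 2 * (s * r) * cos t + (s * r)\<^sup>2 * ((cos t)\<^sup>2 + (sin t)\<^sup>2)"
      by algebra
    finally show ?thesis by simp
  qed
  have "s * r * cos x \<le> s * r * cos y" using s cos by (intro mult_left_mono) auto
  then have "(cmod (1 - of_real s * circle_point r y))\<^sup>2 \<le> (cmod (1 - of_real s * circle_point r x))\<^sup>2"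
    unfolding eq by simp
  then show ?thesis by (rule power2_le_imp_le) simp
qed

text \<open>
  On the circle of radius \<open>r\<close>, \<open>|1 - s z|\<close> ranges from \<open>1 - s r\<close> at \<open>\<theta> = 0\<close> to \<open>1 + s r\<close> at \<open>\<theta> = pi\<close> for both values
  of \<open>s\<close>; the sign \<open>\<sigma>\<close> decides which of these points, \<open>p\<close> and \<open>q\<close> in the proof, is the minimum and
  which the maximum of \<open>\<sigma> ln |1 - s z|\<close>.
\<close>
lemma integral_convex_log_product_le:
  fixes \<Phi> :: "real \<Rightarrow> real" and s1 s2 \<sigma> :: real
  assumes cvx: "convex_on UNIV \<Phi>" and mono: "mono \<Phi>" and \<sigma>: "\<sigma> = 1 \<or> \<sigma> = -1"
    and s1: "0 < s1" "s1 \<le> 1" and s2: "0 < s2" "s2 \<le> 1" and r: "0 < r" "r < 1"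
    and \<omega>1: "\<omega>1 holomorphic_on ball 0 1" "\<And>z. z \<in> ball 0 1 \<Longrightarrow> cmod (\<omega>1 z) \<le> cmod z"
    and \<omega>2: "\<omega>2 holomorphic_on ball 0 1" "\<And>z. z \<in> ball 0 1 \<Longrightarrow> cmod (\<omega>2 z) \<le> cmod z"
  shows "integral {-pi..pi} (\<lambda>\<theta>. \<Phi> (\<sigma> * ln (cmod (1 - of_real s1 * \<omega>1 (circle_point r \<theta>)))
        + \<sigma> * ln (cmod (1 - of_real s2 * \<omega>2 (circle_point r \<theta>)))))
      \<le> integral {-pi..pi} (\<lambda>\<theta>. \<Phi> (\<sigma> * ln (cmod (1 - of_real s1 * circle_point r \<theta>))
        + \<sigma> * ln (cmod (1 - of_real s2 * circle_point r \<theta>))))"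
proof -
  define L where "L s w = \<sigma> * ln (cmod (1 - of_real s * w))" for s w
  have circ: "circle_point r \<theta> \<in> ball 0 1" "cmod (circle_point r \<theta>) \<le> r" for \<theta>
    using r by (simp_all add: norm_mult)
  have contL: "continuous_on {-pi..pi} (\<lambda>\<theta>. L s (\<omega> (circle_point r \<theta>)))"
    if s: "0 < s" "s \<le> 1" and \<omega>: "\<omega> holomorphic_on ball 0 1" "\<And>z. z \<in> ball 0 1 \<Longrightarrow> cmod (\<omega> z) \<le> cmod z" for s \<omega>
  proof -
    have "continuous_on {-pi..pi} (\<lambda>\<theta>. \<omega> (circle_point r \<theta>))"
      by (rule continuous_on_compose2[OF holomorphic_on_imp_continuous_on[OF \<omega>(1)]])
        (intro continuous_intros, use circ in auto)
    moreover have "of_real s * \<omega> (circle_point r \<theta>) \<noteq> 1" for \<theta>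
      by (rule ln_norm_one_minus_bounds(4)[OF _ s(2) order_trans[OF \<omega>(2)[OF circ(1)] circ(2)] r(2)])
        (use s in simp)
    ultimately show ?thesis unfolding L_def by (intro continuous_intros) auto
  qed
  define p where "p = (if \<sigma> = 1 then 0 else pi)"
  define q where "q = (if \<sigma> = 1 then pi else 0)"
  have Lp: "L s (circle_point r p) = (if \<sigma> = 1 then ln (1 - s * r) else - ln (1 + s * r))"
    and Lq: "L s (circle_point r q) = (if \<sigma> = 1 then ln (1 + s * r) else - ln (1 - s * r))"
    if s: "0 < s" "s \<le> 1" for s
  proof -
    have pos: "1 - s * r > 0" "1 + s * r > 0"
      using ln_norm_one_minus_bounds(3)[of s "of_real r" r] s r by (auto simp: add_pos_pos)
    have "1 - of_real s * circle_point r 0 = complex_of_real (1 - s * r)"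
      "1 - of_real s * circle_point r pi = complex_of_real (1 + s * r)"
      by simp_all
    then have "cmod (1 - of_real s * circle_point r 0) = 1 - s * r"
      and "cmod (1 - of_real s * circle_point r pi) = 1 + s * r"
      using pos by (metis norm_of_real abs_of_pos)+
    then show "L s (circle_point r p) = (if \<sigma> = 1 then ln (1 - s * r) else - ln (1 + s * r))"
      "L s (circle_point r q) = (if \<sigma> = 1 then ln (1 + s * r) else - ln (1 - s * r))"
      using \<sigma> by (auto simp: L_def p_def q_def)
  qed
  have range: "L s (circle_point r p) \<le> L s w" "L s w \<le> L s (circle_point r q)"
    if s: "0 < s" "s \<le> 1" and w: "cmod w \<le> r" for s w
    unfolding Lp[OF s] Lq[OF s] 
    using ln_norm_one_minus_bounds(1,2)[OF less_imp_le[OF s(1)] s(2) w r(2)] \<sigma> by (auto simp: L_def)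
  have strict: "L s (circle_point r p) < L s (circle_point r q)" if s: "0 < s" "s \<le> 1" for s
  proof -
    have "0 < s * r" "1 - s * r > 0"
      using ln_norm_one_minus_bounds(3)[of s "of_real r" r] s r by auto
    then have "ln (1 - s * r) < ln (1 + s * r)" by simp
    then show ?thesis unfolding Lp[OF s] Lq[OF s] by simp
  qed
  have mono_L: "if \<sigma> = 1 then L s (circle_point r y) \<le> L s (circle_point r x)
      else L s (circle_point r x) \<le> L s (circle_point r y)"
    if s: "0 < s" "s \<le> 1" and "cos x \<le> cos y" for s x y
  proof -
    have "cmod (1 - of_real s * circle_point r y) > 0"
      using ln_norm_one_minus_bounds(4)[OF _ s(2) circ(2) r(2), of y] s by auto
    then have "ln (cmod (1 - of_real s * circle_point r y)) \<le> ln (cmod (1 - of_real s * circle_point r x))"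
      using norm_one_minus_circle_point_mono[of s r x y] s r that(3) by (intro ln_mono) auto
    then show ?thesis using \<sigma> by (auto simp: L_def)
  qed
  have hinge: "integral {-pi..pi} (\<lambda>\<theta>. max 0 (L s (\<omega> (circle_point r \<theta>)) - k))
      \<le> integral {-pi..pi} (\<lambda>\<theta>. max 0 (L s (circle_point r \<theta>) - k))"
    if s: "0 < s" "s \<le> 1" and \<omega>: "\<omega> holomorphic_on ball 0 1" "\<And>z. z \<in> ball 0 1 \<Longrightarrow> cmod (\<omega> z) \<le> cmod z" for s \<omega> k
    unfolding L_def using s by (intro Littlewood_hinge_log \<omega> r) auto
  have id: "(\<lambda>z::complex. z) holomorphic_on ball 0 1" by (rule holomorphic_on_ident)
  have le: "cmod (\<omega> (circle_point r x)) \<le> r" if "\<And>z. z \<in> ball 0 1 \<Longrightarrow> cmod (\<omega> z) \<le> cmod z" for \<omega> x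
    by (rule order_trans[OF that[OF circ(1)] circ(2)])
  have "integral {-pi..pi} (\<lambda>\<theta>. \<Phi> (L s1 (\<omega>1 (circle_point r \<theta>)) + L s2 (\<omega>2 (circle_point r \<theta>))))
      \<le> integral {-pi..pi} (\<lambda>\<theta>. \<Phi> (L s1 (circle_point r \<theta>) + L s2 (circle_point r \<theta>)))"
  proof (rule integral_convex_mono_le_comonotone_sum[OF cvx mono, where p=p and q=q])
    show "p \<in> {-pi..pi}" "q \<in> {-pi..pi}" by (auto simp: p_def q_def)
    show "L s1 (circle_point r p) + L s2 (circle_point r p) < L s1 (circle_point r q) + L s2 (circle_point r q)"
      using strict[OF s1] strict[OF s2] by (rule add_strict_mono)
    fix x
    show "L s1 (\<omega>1 (circle_point r x)) \<le> L s1 (circle_point r q)"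
      by (rule range(2)[OF s1 le[OF \<omega>1(2)]])
    show "L s2 (\<omega>2 (circle_point r x)) \<le> L s2 (circle_point r q)"
      by (rule range(2)[OF s2 le[OF \<omega>2(2)]])
    show "L s1 (circle_point r p) + L s2 (circle_point r p) \<le> L s1 (circle_point r x) + L s2 (circle_point r x)
      \<and> L s1 (circle_point r x) + L s2 (circle_point r x) \<le> L s1 (circle_point r q) + L s2 (circle_point r q)"
      by (intro conjI add_mono range s1 s2 circ)
    fix y
    show "L s1 (circle_point r x) \<le> L s1 (circle_point r y) \<and> L s2 (circle_point r x) \<le> L s2 (circle_point r y)
      \<or> L s1 (circle_point r y) \<le> L s1 (circle_point r x) \<and> L s2 (circle_point r y) \<le> L s2 (circle_point r x)"
      using mono_L[OF s1, of x y] mono_L[OF s2, of x y] mono_L[OF s1, of y x] mono_L[OF s2, of y x]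
      by (metis linear)
  qed (intro contL[OF s1 \<omega>1] contL[OF s2 \<omega>2] contL[OF s1 id] contL[OF s2 id] hinge s1 s2 \<omega>1 \<omega>2 order_refl; assumption)+
  then show ?thesis by (simp only: L_def)
qed

lemma convex_on_shift:
  fixes \<Phi> :: "real \<Rightarrow> real"
  assumes "convex_on UNIV \<Phi>"
  shows "convex_on UNIV (\<lambda>x. \<Phi> (c + x))"
proof (rule convex_onI)
  fix t x y :: real assume t: "0 < t" "t < 1"
  have "c + ((1 - t) *\<^sub>R x + t *\<^sub>R y) = (1 - t) *\<^sub>R (c + x) + t *\<^sub>R (c + y)"
    by (simp add: algebra_simps)
  then show "\<Phi> (c + ((1 - t) *\<^sub>R x + t *\<^sub>R y)) \<le> (1 - t) * \<Phi> (c + x) + t * \<Phi> (c + y)"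
    using convex_onD[OF assms, of t "c + x" "c + y"] t by simp
qed simp

theorem theorem2p3:
  fixes \<Phi> :: "real \<Rightarrow> real" and f :: "complex \<Rightarrow> complex" and l r :: real
  assumes "convex_on UNIV \<Phi>" and "mono \<Phi>"
    and "0 < l" and "l \<le> 1"
    and "f \<in> class_U l"
    and "0 < r" and "r < 1"
  shows "integral {-pi..pi} (\<lambda>\<theta>. \<Phi> (ln (cmod (f (complex_of_real r * exp (\<i> * complex_of_real \<theta>))))))
       \<le> integral {-pi..pi} (\<lambda>\<theta>. \<Phi> (ln (cmod (k_fun l (complex_of_real r * exp (\<i> * complex_of_real \<theta>))))))
    \<and> integral {-pi..pi} (\<lambda>\<theta>. \<Phi> (- ln (cmod (f (complex_of_real r * exp (\<i> * complex_of_real \<theta>))))))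
       \<le> integral {-pi..pi} (\<lambda>\<theta>. \<Phi> (- ln (cmod (k_fun l (complex_of_real r * exp (\<i> * complex_of_real \<theta>))))))"
proof -
  obtain A where A: "A holomorphic_on ball 0 1" "l-lipschitz_on (ball 0 1) A"
      "\<And>z. z \<in> ball 0 1 \<Longrightarrow> 1 + z * A z \<noteq> 0"
    and zf: "\<And>z. z \<in> ball 0 1 \<Longrightarrow> z = f z * (1 + z * A z)"
    using class_U_reciprocal[OF assms(5) less_imp_le[OF assms(3)]] by blast
  obtain c \<omega> where c: "cmod c \<le> 1" and \<omega>: "\<omega> holomorphic_on ball 0 1"
      "\<And>z. z \<in> ball 0 1 \<Longrightarrow> cmod (\<omega> z) \<le> cmod z"
    and fac: "\<And>z. z \<in> ball 0 1 \<Longrightarrow> 1 + z * A z = (1 - c * z) * (1 - of_real l * \<omega> z)"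
    using zero_free_lipschitz_factorization[OF A(1,2) assms(3,4) A(3)] by blast
  have \<omega>c: "(\<lambda>z. c * z) holomorphic_on ball 0 1" "\<And>z. z \<in> ball 0 1 \<Longrightarrow> cmod (c * z) \<le> cmod z"
    using mult_right_mono[OF c norm_ge_zero] by (auto intro!: holomorphic_intros simp: norm_mult)
  have circ: "circle_point r \<theta> \<in> ball 0 1" "cmod (circle_point r \<theta>) = r" "circle_point r \<theta> \<noteq> 0" for \<theta>
    using assms(6,7) by (simp_all add: norm_mult)
  have ln_quotient: "ln (cmod w) = ln r - ln (cmod (1 - u)) - ln (cmod (1 - v))"
    if "z = w * ((1 - u) * (1 - v))" "cmod z = r" for z w u v
  proof -
    have "w \<noteq> 0" "1 - u \<noteq> 0" "1 - v \<noteq> 0" "cmod w * (cmod (1 - u) * cmod (1 - v)) = r"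
      using that assms(6) by (auto simp: norm_mult)
    then show ?thesis by (auto simp: ln_mult)
  qed
  have f_eq: "ln (cmod (f (circle_point r \<theta>)))
      = ln r - ln (cmod (1 - c * circle_point r \<theta>)) - ln (cmod (1 - of_real l * \<omega> (circle_point r \<theta>)))" for \<theta>
    by (rule ln_quotient[OF _ circ(2)[of \<theta>]]) (use zf[OF circ(1)] fac[OF circ(1)] in metis)
  have k_eq: "ln (cmod (k_fun l (circle_point r \<theta>)))
      = ln r - ln (cmod (1 - circle_point r \<theta>)) - ln (cmod (1 - of_real l * circle_point r \<theta>))" for \<theta>
  proof (rule ln_quotient[OF _ circ(2)[of \<theta>]])
    have "1 - circle_point r \<theta> \<noteq> 0" "1 - of_real l * circle_point r \<theta> \<noteq> 0"
      using ln_norm_one_minus_bounds(4)[of 1 "circle_point r \<theta>" r] ln_norm_one_minus_bounds(4)[of l "circle_point r \<theta>" r]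
        circ(2) assms by auto
    then show "circle_point r \<theta>
        = k_fun l (circle_point r \<theta>) * ((1 - circle_point r \<theta>) * (1 - of_real l * circle_point r \<theta>))"
      unfolding k_fun_def by simp
  qed
  have shifted: "convex_on UNIV (\<lambda>x. \<Phi> (a + x))" "mono (\<lambda>x. \<Phi> (a + x))" for a
    using convex_on_shift[OF assms(1)] assms(2) by (auto simp: mono_def)
  note ineq = integral_convex_log_product_le[OF shifted _ zero_less_one order_refl assms(3,4,6,7) \<omega>c \<omega>]
  show ?thesis
    unfolding f_eq k_eq using ineq[of "-1" "ln r"] ineq[of 1 "- ln r"] by (simp add: algebra_simps)
qed

end
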